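(* Let $N$ be the number of regions in the bottom layer, let $T$ be the number of time intervals, and suppose that every region has exactly $M$ children in the next lower layer. Then the computational complexity (number of arithmetic operations) of the $K$-layer nested rebalancing algorithm $\mathrm{NERO}_K$ is $$O\left(C\left(\frac{NT}{M^{K-1}}+2T,\ \frac{N^2T}{M^{2(K-1)}}+\frac{2NT}{M^{K-1}}\right)+C\left(MT+2T,\ M^2T+2MT\right)\frac{NM(M^{K-1}-1)}{M^{K-1}(M-1)}\right),$$ where $C(m,n)$ is the number of arithmetic operations used by the LP solver on a linear program with $m$ constraints and $n$ decision variables.
   Context: Optimal rebalancing problem with time-varying fleet size, on a finite set $\mathcal N$ of regions and time intervals $\mathcal T=[1,\dots,T]$. Given: travel times $\tau_{ij}\in\mathbb N$, travel costs $c_{ij}$, numbers of requests $\lambda_{ijt}$ from $i$ to $j$ departing at $t$, fleet sizes $V_t$ (with $V_0=0$). Unknowns: $x^p_{ijt}$ (vehicles transporting customers from $i$ to $j$ departing at $t$), $x^r_{ijt}$ (rebalancing vehicles from $i$ to $j$ departing at $t$), $x^a_{it}$ (empty vehicles arriving in $i$ from outside $\mathcal N$ at $t$), $x^d_{it}$ (vehicles departing from $i$ to outside $\mathcal N$ at $t$), $s_{i0}$ (initially available vehicles), all in $\mathbb N$; $x^r,x^p$ at nonpositive times are $0$. Minimize $\sum_{t,i,j}c_{ij}x^r_{ijt}$ subject to: $x^p_{ijt}=\lambda_{ijt}$; $\sum_{j}(x^r_{ijt}+x^p_{ijt}-x^r_{ji,t-\tau_{ji}}-x^p_{ji,t-\tau_{ji}})=s_{it}$,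 where $s_{i1}=s_{i0}$ and $s_{it}=x^a_{it}-x^d_{it}$ for $t>1$; $\sum_i\big(s_{it}+\sum_j\sum_{\Delta t=1}^{\tau_{ji}}(x^r_{ji,t-\Delta t}+x^p_{ji,t-\Delta t})\big)=V_t$; $\sum_i x^a_{it}=\max(V_t-V_{t-1},0)$; $\sum_i x^d_{it}=\max(V_{t-1}-V_t,0)$. The problem is solved by one call to an LP solver, and on $n_0$ regions it is counted as having $n_0T+2T$ constraints and $n_0^2T+2n_0T$ decision variables. $\mathrm{NERO}_K$: the whole area is organised in $K$ layers of regions (layer $1$ = top, coarsest; layer $K$ = bottom, finest). Each region $l$ of a layer above the bottom is segmented into a set $\mathcal N_l$ of regions of the next lower layer, its children; every such set has $M$ elements. The algorithm first solves the optimal rebalancing problem with time-varying fleet size on the set of all top-layer regions, with the externally given fleet sizes. Then, recursively down the layers, for each region $l$ above the bottom layer it solves the optimal rebalancing problem with time-varying fleet size on $\mathcal N_l$, using the customer demand within $\mathcal N_l$ and the fleet sizes $V_{lt}=s_{lt}+\sum_{j}(x^r_{jl,t-\tau_{jl}}+x^p_{jl,t-\tau_{jl}})$ computed from the already optimized policy on the set of regions containing $l$ (the sum is over that set; $s_{l1}=s_{l0}$ and $s_{lt}=x^a_{lt}-x^d_{lt}$ for $t>1$). The output is the collection of all the policies. The computational complexity is the total number of arithmetic operations of the LP solves. *)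

theory Defs
  imports Complex_Main "HOL-Library.Landau_Symbols" "HOL-Library.Disjoint_Sets"
begin

section \<open>Optimal rebalancing with time-varying fleet size\<close>

text \<open>Time is \<^typ>\<open>int\<close>, so that \<open>t - \<tau>\<close> may be nonpositive. Fleet sizes are integers because
  those of a nested problem are computed from the signed quantities \<open>s\<^sub>i\<^sub>t\<close>.\<close>

record 'r rebal_problem =
  regions :: "'r set"
  horizon :: nat
  travel_time :: "'r \<Rightarrow> 'r \<Rightarrow> nat"
  travel_cost :: "'r \<Rightarrow> 'r \<Rightarrow> real"
  demand :: "'r \<Rightarrow> 'r \<Rightarrow> int \<Rightarrow> nat"
  fleet :: "int \<Rightarrow> int"

record 'r policy =
  xp :: "'r \<Rightarrow> 'r \<Rightarrow> int \<Rightarrow> nat"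
  xr :: "'r \<Rightarrow> 'r \<Rightarrow> int \<Rightarrow> nat"
  xa :: "'r \<Rightarrow> int \<Rightarrow> nat"
  xd :: "'r \<Rightarrow> int \<Rightarrow> nat"
  s0 :: "'r \<Rightarrow> nat"

definition vehicles :: "'r policy \<Rightarrow> 'r \<Rightarrow> 'r \<Rightarrow> int \<Rightarrow> int" where
  "vehicles x i j t = int (xr x i j t) + int (xp x i j t)"

definition net_supply :: "'r policy \<Rightarrow> 'r \<Rightarrow> int \<Rightarrow> int" where
  "net_supply x i t = (if t = 1 then int (s0 x i) else int (xa x i t) - int (xd x i t))"

text \<open>The convention \<open>V\<^sub>0 = 0\<close> is built in, whatever the value of the field \<^const>\<open>fleet\<close> at 0.\<close>

definition fleet_at :: "'r rebal_problem \<Rightarrow> int \<Rightarrow> int" where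
  "fleet_at P t = (if t \<le> 0 then 0 else fleet P t)"

definition feasible :: "'r rebal_problem \<Rightarrow> 'r policy \<Rightarrow> bool" where
  "feasible P x \<longleftrightarrow>
    (\<forall>i\<in>regions P. \<forall>j\<in>regions P. \<forall>t\<le>0. xr x i j t = 0 \<and> xp x i j t = 0) \<and>
    (\<forall>t\<in>{1..int (horizon P)}.
      (\<forall>i\<in>regions P. \<forall>j\<in>regions P. xp x i j t = demand P i j t) \<and>
      (\<forall>i\<in>regions P.
        (\<Sum>j\<in>regions P. vehicles x i j t - vehicles x j i (t - int (travel_time P j i))) = net_supply x i t) \<and>
      (\<Sum>i\<in>regions P. net_supply x i t +
        (\<Sum>j\<in>regions P. \<Sum>d = 1..travel_time P j i. vehicles x j i (t - int d))) = fleet_at P t \<and>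
      (\<Sum>i\<in>regions P. int (xa x i t)) = max (fleet_at P t - fleet_at P (t - 1)) 0 \<and>
      (\<Sum>i\<in>regions P. int (xd x i t)) = max (fleet_at P (t - 1) - fleet_at P t) 0)"

definition rebal_cost :: "'r rebal_problem \<Rightarrow> 'r policy \<Rightarrow> real" where
  "rebal_cost P x =
    (\<Sum>t = 1..int (horizon P). \<Sum>i\<in>regions P. \<Sum>j\<in>regions P. travel_cost P i j * real (xr x i j t))"

definition optimal :: "'r rebal_problem \<Rightarrow> 'r policy \<Rightarrow> bool" where
  "optimal P x \<longleftrightarrow> feasible P x \<and> (\<forall>y. feasible P y \<longrightarrow> rebal_cost P x \<le> rebal_cost P y)"

section \<open>The LP solver\<close>

text \<open>The size is a counting convention, not a literal count of the constraints in
  \<^const>\<open>feasible\<close>: it has one flow constraint per region and interval and two aggregate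
  constraints per interval (of the three), and the variables \<open>x\<^sup>r\<close>, \<open>x\<^sup>a\<close>, \<open>x\<^sup>d\<close>
  (\<open>x\<^sup>p\<close> is given by the demand; \<open>s\<^sub>i\<^sub>0\<close> is left out).\<close>

definition num_constraints :: "'r rebal_problem \<Rightarrow> nat" where
  "num_constraints P = card (regions P) * horizon P + 2 * horizon P"

definition num_variables :: "'r rebal_problem \<Rightarrow> nat" where
  "num_variables P = (card (regions P))^2 * horizon P + 2 * card (regions P) * horizon P"

text \<open>A call of the solver yields a policy and the number of arithmetic operations it has used.
  Nothing is assumed about the policy when the problem has no optimal policy; the operation
  bound holds for every call.\<close>

definition lp_solver ::
    "('r rebal_problem \<Rightarrow> 'r policy \<times> nat) \<Rightarrow> (nat \<Rightarrow> nat \<Rightarrow> nat) \<Rightarrow> bool" where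
  "lp_solver solve C \<longleftrightarrow>
    (\<forall>P. finite (regions P) \<longrightarrow>
      ((\<exists>x. optimal P x) \<longrightarrow> optimal P (fst (solve P))) \<and>
      snd (solve P) \<le> C (num_constraints P) (num_variables P))"

section \<open>Nested rebalancing\<close>

record 'r nero_instance =
  num_layers :: nat
  branching :: nat
  intervals :: nat
  layer :: "nat \<Rightarrow> 'r set"
  children :: "'r \<Rightarrow> 'r set"
  tau :: "'r \<Rightarrow> 'r \<Rightarrow> nat"
  cost :: "'r \<Rightarrow> 'r \<Rightarrow> real"
  requests :: "'r \<Rightarrow> 'r \<Rightarrow> int \<Rightarrow> nat"
  total_fleet :: "int \<Rightarrow> nat"

definition nero_valid :: "'r nero_instance \<Rightarrow> bool" where
  "nero_valid I \<longleftrightarrow>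
    num_layers I \<ge> 1 \<and> branching I \<ge> 2 \<and> intervals I \<ge> 1 \<and>
    (\<forall>k\<in>{1..num_layers I}. finite (layer I k)) \<and>
    disjoint_family_on (layer I) {1..num_layers I} \<and>
    (\<forall>k\<in>{1..<num_layers I}.
      disjoint_family_on (children I) (layer I k) \<and>
      (\<Union>l\<in>layer I k. children I l) = layer I (k + 1) \<and>
      (\<forall>l\<in>layer I k. card (children I l) = branching I))"

definition subproblem :: "'r nero_instance \<Rightarrow> 'r set \<Rightarrow> (int \<Rightarrow> int) \<Rightarrow> 'r rebal_problem" where
  "subproblem I S V =
    \<lparr>regions = S, horizon = intervals I, travel_time = tau I, travel_cost = cost I,
     demand = requests I, fleet = V\<rparr>"

definition induced_fleet :: "'r nero_instance \<Rightarrow> 'r set \<Rightarrow> 'r policy \<Rightarrow> 'r \<Rightarrow> int \<Rightarrow> int" where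
  "induced_fleet I S x l t = net_supply x l t + (\<Sum>j\<in>S. vehicles x j l (t - int (tau I j l)))"

text \<open>\<open>nero_from solve I d S V\<close> processes the region set \<open>S\<close> with fleet sizes \<open>V\<close> and the \<open>d\<close>
  layers below it. It returns the computed policies, each paired with its region set, and the
  total number of arithmetic operations of the solver calls.\<close>

primrec nero_from ::
    "('r rebal_problem \<Rightarrow> 'r policy \<times> nat) \<Rightarrow> 'r nero_instance \<Rightarrow> nat \<Rightarrow> 'r set \<Rightarrow> (int \<Rightarrow> int) \<Rightarrow>
      ('r set \<times> 'r policy) set \<times> nat" where
  "nero_from solve I 0 S V =
    (let (x, a) = solve (subproblem I S V) in ({(S, x)}, a))"
| "nero_from solve I (Suc d) S V =
    (let (x, a) = solve (subproblem I S V);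
         below = (\<lambda>l. nero_from solve I d (children I l) (induced_fleet I S x l))
     in (insert (S, x) (\<Union>l\<in>S. fst (below l)), a + (\<Sum>l\<in>S. snd (below l))))"

definition nero ::
    "('r rebal_problem \<Rightarrow> 'r policy \<times> nat) \<Rightarrow> 'r nero_instance \<Rightarrow>
      ('r set \<times> 'r policy) set \<times> nat" where
  "nero solve I = nero_from solve I (num_layers I - 1) (layer I 1) (\<lambda>t. int (total_fleet I t))"

definition nero_complexity ::
    "('r rebal_problem \<Rightarrow> 'r policy \<times> nat) \<Rightarrow> 'r nero_instance \<Rightarrow> nat" where
  "nero_complexity solve I = snd (nero solve I)"

end

theory Submission
  imports Defs
begin

text \<open>
  The algorithm makes one solver call on the top layer and one on the set of children of every
  region above the bottom layer. All the latter sets have \<open>M\<close> elements, so each of these calls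
  costs at most \<open>C (M T + 2 T) (M\<^sup>2 T + 2 M T)\<close>, and it remains to count regions
  (\<open>nero_from_cost_le\<close> does the accounting along the recursion). As the children partition the next
  layer, the layers grow by the factor \<open>M\<close>: with \<open>n\<close> regions on top, layer \<open>k\<close> has
  \<open>n M ^ (k - 1)\<close> of them (\<open>card_layer\<close>). Hence \<open>n = N / M ^ (K - 1)\<close>, with no remainder, which
  turns the size of the top-level program into the one in the first summand; and there are
  \<open>n (1 + M + \<dots> + M ^ (K - 2)) = N (M ^ (K - 1) - 1) / (M ^ (K - 1) (M - 1))\<close> nested programs.
  The bound charges for \<open>M\<close> times as many, so it holds with constant \<open>1\<close> for every valid
  instance.
\<close>

lemma solver_call_cost_le:
  assumes "lp_solver solve C" "finite S"
  shows "snd (solve (subproblem I S V)) \<le>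
    C (card S * intervals I + 2 * intervals I)
      ((card S)\<^sup>2 * intervals I + 2 * card S * intervals I)"
proof -
  have "finite (regions (subproblem I S V))"
    using assms(2) by (simp add: subproblem_def)
  then have "snd (solve (subproblem I S V)) \<le>
      C (num_constraints (subproblem I S V)) (num_variables (subproblem I S V))"
    using assms(1) unfolding lp_solver_def by blast
  then show ?thesis
    by (simp add: num_constraints_def num_variables_def subproblem_def)
qed

lemma
  assumes "nero_valid I" "k \<in> {1..<num_layers I}" "l \<in> layer I k"
  shows card_children: "card (children I l) = branching I"
    and children_subset_layer: "children I l \<subseteq> layer I (Suc k)"
proof -
  have "(\<Union>l\<in>layer I k. children I l) = layer I (Suc k)"
    and "\<forall>l\<in>layer I k. card (children I l) = branching I"
    using assms(1,2) by (simp_all add: nero_valid_def)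
  then show "card (children I l) = branching I" "children I l \<subseteq> layer I (Suc k)"
    using assms(3) by blast+
qed

lemma card_layer_Suc:
  assumes "nero_valid I" "k \<in> {1..<num_layers I}"
  shows "card (layer I (Suc k)) = card (layer I k) * branching I"
proof -
  have fin: "finite (layer I k)" and disj: "disjoint_family_on (children I) (layer I k)"
    and un: "(\<Union>l\<in>layer I k. children I l) = layer I (Suc k)" and M: "branching I \<ge> 2"
    using assms by (auto simp: nero_valid_def)
  have "finite (children I l)" if "l \<in> layer I k" for l
    using card_children[OF assms that] M by (intro card_ge_0_finite) linarith
  then have "card (\<Union>l\<in>layer I k. children I l) = (\<Sum>l\<in>layer I k. card (children I l))"
    using fin disj by (intro card_UN_disjoint) (auto simp: disjoint_family_on_def)
  also have "\<dots> = card (layer I k) * branching I"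
    using card_children[OF assms] by simp
  finally show ?thesis by (simp add: un)
qed

lemma card_layer:
  assumes "nero_valid I" "k < num_layers I"
  shows "card (layer I (Suc k)) = card (layer I 1) * branching I ^ k"
  using assms(2)
proof (induction k)
  case (Suc k)
  then show ?case
    using card_layer_Suc[OF assms(1), of "Suc k"] by simp
qed simp

text \<open>
  The call on \<open>S\<close> itself, whose size is arbitrary, is kept apart from the calls on sets of
  children, which all have the same cost bound. In the recursive step the first call made for
  each child set becomes one of the latter, contributing the summand \<open>1\<close> to the geometric sum.
\<close>

lemma nero_from_cost_le:
  assumes solver: "lp_solver solve C" and valid: "nero_valid I"
    and "k \<ge> 1" "k + d = num_layers I" "S \<subseteq> layer I k"
  defines "M \<equiv> branching I" and "T \<equiv> intervals I"
  shows "snd (nero_from solve I d S V) \<le>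
    C (card S * T + 2 * T) ((card S)\<^sup>2 * T + 2 * card S * T) +
    C (M * T + 2 * T) (M\<^sup>2 * T + 2 * M * T) * (card S * (\<Sum>i<d. M ^ i))"
  using \<open>k \<ge> 1\<close> \<open>k + d = num_layers I\<close> \<open>S \<subseteq> layer I k\<close>
proof (induction d arbitrary: k S V)
  case 0
  then have "finite S"
    using valid unfolding nero_valid_def by (auto intro: finite_subset)
  then show ?case
    using solver_call_cost_le[OF solver, of S I V] by (cases "solve (subproblem I S V)") (simp add: T_def)
next
  case (Suc d)
  define c where "c = C (M * T + 2 * T) (M\<^sup>2 * T + 2 * M * T)"
  have k: "k \<in> {1..<num_layers I}"
    using Suc.prems by simp
  then have "finite S"
    using valid Suc.prems unfolding nero_valid_def by (auto intro: finite_subset)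
  obtain x a where xa: "solve (subproblem I S V) = (x, a)"
    by fastforce
  have below: "snd (nero_from solve I d (children I l) (induced_fleet I S x l)) \<le>
      c * (\<Sum>i<Suc d. M ^ i)" if "l \<in> S" for l
  proof -
    have "l \<in> layer I k" using that Suc.prems by blast
    note card_children[OF valid k this] children_subset_layer[OF valid k this]
    then have "snd (nero_from solve I d (children I l) (induced_fleet I S x l)) \<le>
        c + c * (M * (\<Sum>i<d. M ^ i))"
      using Suc.IH[of "Suc k" "children I l"] Suc.prems by (simp add: c_def M_def)
    also have "\<dots> = c * (\<Sum>i<Suc d. M ^ i)"
      unfolding sum.lessThan_Suc_shift by (simp add: sum_distrib_left algebra_simps)
    finally show ?thesis .
  qed
  have "snd (nero_from solve I (Suc d) S V) =
      a + (\<Sum>l\<in>S. snd (nero_from solve I d (children I l) (induced_fleet I S x l)))"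
    by (simp add: xa)
  also have "\<dots> \<le> a + (\<Sum>l\<in>S. c * (\<Sum>i<Suc d. M ^ i))"
    using below by (intro add_left_mono sum_mono)
  also have "\<dots> = a + c * (card S * (\<Sum>i<Suc d. M ^ i))"
    by (simp only: sum_constant) (simp add: algebra_simps)
  also have "a \<le> C (card S * T + 2 * T) ((card S)\<^sup>2 * T + 2 * card S * T)"
    using solver_call_cost_le[OF solver \<open>finite S\<close>, of I V] by (simp add: xa T_def)
  finally show ?case by (simp add: c_def)
qed

theorem proposition1:
  fixes solve :: "'r rebal_problem \<Rightarrow> 'r policy \<times> nat"
    and C :: "nat \<Rightarrow> nat \<Rightarrow> nat"
  assumes "lp_solver solve C"
  shows "(\<lambda>I. real (nero_complexity solve I)) \<in> O[principal {I. nero_valid I}](\<lambda>I.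
    let K = num_layers I; M = branching I; T = intervals I; N = card (layer I K) in
      real (C ((N * T) div M ^ (K - 1) + 2 * T)
              ((N ^ 2 * T) div M ^ (2 * (K - 1)) + (2 * N * T) div M ^ (K - 1))) +
      real (C (M * T + 2 * T) (M ^ 2 * T + 2 * M * T)) *
        (real N * real M * (real M ^ (K - 1) - 1) / (real M ^ (K - 1) * (real M - 1))))"
    (is "_ \<in> O[_](?bound)")
proof (rule bigoI[where c = 1])
  have "norm (real (nero_complexity solve I)) \<le> 1 * norm (?bound I)" if valid: "nero_valid I" for I
  proof -
    define K M T N n where
      "K = num_layers I" and "M = branching I" and "T = intervals I" and
      "N = card (layer I K)" and "n = card (layer I 1)"
    have K: "K \<ge> 1" and M: "M \<ge> 2"
      using valid by (auto simp: nero_valid_def K_def M_def)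
    have N: "N = n * M ^ (K - 1)"
      using card_layer[OF valid, of "K - 1"] K by (simp add: N_def M_def n_def K_def)
    have sizes: "(N * T) div M ^ (K - 1) = n * T" "(N\<^sup>2 * T) div M ^ (2 * (K - 1)) = n\<^sup>2 * T"
        "(2 * N * T) div M ^ (K - 1) = 2 * n * T"
    proof -
      have eqs: "N * T = n * T * M ^ (K - 1)" "2 * N * T = 2 * n * T * M ^ (K - 1)"
          "N\<^sup>2 * T = n\<^sup>2 * T * M ^ (2 * (K - 1))"
        by (simp_all add: N power_mult_distrib mult.commute flip: power_mult)
      have "M ^ e \<noteq> 0" for e
        using M by simp
      then show "(N * T) div M ^ (K - 1) = n * T"
          "(N\<^sup>2 * T) div M ^ (2 * (K - 1)) = n\<^sup>2 * T"
          "(2 * N * T) div M ^ (K - 1) = 2 * n * T"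
        unfolding eqs by (rule nonzero_mult_div_cancel_right)+
    qed
    define top c where "top = C (n * T + 2 * T) (n\<^sup>2 * T + 2 * n * T)"
      and "c = C (M * T + 2 * T) (M\<^sup>2 * T + 2 * M * T)"
    have "nero_complexity solve I \<le> top + c * (n * (\<Sum>i<K - 1. M ^ i))"
      using nero_from_cost_le[OF assms valid, of 1 "K - 1" "layer I 1"] K
      by (simp add: nero_complexity_def nero_def top_def c_def n_def M_def T_def K_def)
    also have "\<dots> \<le> top + c * (n * (M * (\<Sum>i<K - 1. M ^ i)))"
      using M by (intro add_left_mono mult_left_mono) auto
    finally have "real (nero_complexity solve I) \<le>
        real (top + c * (n * (M * (\<Sum>i<K - 1. M ^ i))))"
      by (rule of_nat_mono)
    also have "\<dots> = real top + real c * (real n * real M * (\<Sum>i<K - 1. real M ^ i))"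
      by simp
    also have "(\<Sum>i<K - 1. real M ^ i) = (real M ^ (K - 1) - 1) / (real M - 1)"
      using M by (intro geometric_sum) simp
    also have "real n * real M * ((real M ^ (K - 1) - 1) / (real M - 1)) =
        real N * real M * (real M ^ (K - 1) - 1) / (real M ^ (K - 1) * (real M - 1))"
      using M by (simp add: N)
    also have "real top + real c * \<dots> = ?bound I"
      unfolding Let_def K_def[symmetric] M_def[symmetric] T_def[symmetric] N_def[symmetric]
        sizes top_def c_def ..
    finally show ?thesis by simp
  qed
  then show "eventually (\<lambda>I. norm (real (nero_complexity solve I)) \<le> 1 * norm (?bound I))
      (principal {I. nero_valid I})"
    by (simp add: eventually_principal)
qed

end
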